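(* Let $n\in\mathbb{N}$, let $\mathbf{L}=(L_1,\ldots,L_n)$ be a random vector of non-negative real random variables (not depending on $d$), and for every integer $d\ge 2$ let $\mathbf{U}^{(d)}_1,\ldots,\mathbf{U}^{(d)}_n$ be i.i.d. $\mathrm{Unif}(S^{d-1})$ random variables with values in $\mathbb{R}^d$ such that $\mathbf{U}^{(d)}_1,\ldots,\mathbf{U}^{(d)}_n$ and $\mathbf{L}$ are independent, all these random variables (for all $d$) being defined on the same complete probability space $(\Omega,\mathcal{F},\mathbb{P})$. Set $\mathbf{S}_{d,n}:=\sum_{k=1}^n L_k\mathbf{U}^{(d)}_k$. Then $$\lim_{d\to+\infty}|\mathbf{S}_{d,n}|_2^2=|\mathbf{L}|_2^2\qquad \mathbb{P}\text{-almost surely}.$$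
   Context: $\mathbb{N}$ denotes the positive integers. $|\cdot|_2$ denotes the Euclidean norm and $S^{d-1}=\{\mathbf{x}\in\mathbb{R}^d: |\mathbf{x}|_2=1\}$. An $\mathbb{R}^d$-valued random variable $\mathbf{V}$ ($d\ge2$) has distribution $\mathrm{Unif}(S^{d-1})$ if there are i.i.d. standard Gaussian real random variables $Z_1,\ldots,Z_d$ such that $\mathbf{V}$ has the same law as $\left(Z_1,\ldots,Z_d\right)/\sqrt{\sum_{h=1}^d Z_h^2}$. The components of $\mathbf{L}$ may be dependent on one another. "$\mathbf{U}^{(d)}_1,\ldots,\mathbf{U}^{(d)}_n$ and $\mathbf{L}$ are independent" means that these $n+1$ random vectors are mutually independent, for each fixed $d$. No assumption is made on the joint law of the $\mathbf{U}^{(d)}_i$ for different $d$. *)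

theory Defs
  imports "HOL-Probability.Probability"
begin

text \<open>
  The dimension \<open>d\<close> varies inside the theorem, so vectors of \<open>\<real>\<^sup>d\<close> are functions
  on the index set \<open>{1..d}\<close>, with the product (= Borel) sigma-algebra. The Euclidean norm of
  \<open>x\<close> is \<open>L2_set x {1..d}\<close>.
\<close>

abbreviation euclid :: "nat \<Rightarrow> (nat \<Rightarrow> real) measure" where
  "euclid d \<equiv> PiM {1..d} (\<lambda>_. borel)"

definition iid_std_gaussian :: "'b measure \<Rightarrow> nat \<Rightarrow> (nat \<Rightarrow> 'b \<Rightarrow> real) \<Rightarrow> bool" where
  "iid_std_gaussian N d Z \<longleftrightarrow>
     prob_space N \<and>
     prob_space.indep_vars N (\<lambda>_. borel) Z {1..d} \<and>
     (\<forall>i\<in>{1..d}. distributed N lborel (Z i) std_normal_density)"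

definition normalized :: "nat \<Rightarrow> (nat \<Rightarrow> 'b \<Rightarrow> real) \<Rightarrow> 'b \<Rightarrow> nat \<Rightarrow> real" where
  "normalized d Z \<omega> = (\<lambda>i\<in>{1..d}. Z i \<omega> / sqrt (\<Sum>h=1..d. (Z h \<omega>)\<^sup>2))"

text \<open>
  The Gaussian variables need not live on the probability space carrying \<open>V\<close>. A definition
  cannot quantify over types, so their space is taken on the type \<open>nat \<Rightarrow> real\<close>; by
  \<open>unif_sphereI\<close> below this is no restriction.
\<close>

definition unif_sphere :: "'a measure \<Rightarrow> nat \<Rightarrow> ('a \<Rightarrow> nat \<Rightarrow> real) \<Rightarrow> bool" where
  "unif_sphere M d V \<longleftrightarrow>
     V \<in> measurable M (euclid d) \<and>
     (\<exists>(N :: (nat \<Rightarrow> real) measure) Z. iid_std_gaussian N d Z \<and>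
        distr M (euclid d) V = distr N (euclid d) (normalized d Z))"

lemma normalized_measurable:
  assumes "\<And>i. i \<in> {1..d} \<Longrightarrow> Z i \<in> borel_measurable N"
  shows "normalized d Z \<in> measurable N (euclid d)"
proof -
  have "(\<lambda>\<omega>. \<lambda>i\<in>{1..d}. Z i \<omega> / sqrt (\<Sum>h=1..d. (Z h \<omega>)\<^sup>2)) \<in> measurable N (euclid d)"
    using assms
    by (intro measurable_restrict borel_measurable_divide
        borel_measurable_sum borel_measurable_power
        measurable_compose[OF _ borel_measurable_sqrt]) auto
  then show ?thesis
    unfolding normalized_def[abs_def] .
qed

lemma unif_sphereI:
  fixes N :: "'b measure"
  assumes V: "V \<in> measurable M (euclid d)"
    and Z: "iid_std_gaussian N d Z"
    and eq: "distr M (euclid d) V = distr N (euclid d) (normalized d Z)"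
  shows "unif_sphere M d V"
proof -
  interpret N: prob_space N using Z by (simp add: iid_std_gaussian_def)
  have indep: "N.indep_vars (\<lambda>_. borel) Z {1..d}"
    and dist: "\<And>i. i \<in> {1..d} \<Longrightarrow> distributed N lborel (Z i) std_normal_density"
    using Z by (auto simp: iid_std_gaussian_def)
  have Zm: "Z i \<in> borel_measurable N" if "i \<in> {1..d}" for i
    using indep that by (auto simp: N.indep_vars_def)
  define W where "W \<omega> = (\<lambda>i\<in>{1..d}. Z i \<omega>)" for \<omega>
  have Wm: "W \<in> measurable N (euclid d)"
    unfolding W_def[abs_def] using Zm by (intro measurable_restrict) auto
  define K where "K = distr N (euclid d) W"
  interpret K: prob_space K unfolding K_def by (rule N.prob_space_distr[OF Wm])
  let ?Y = "\<lambda>i (x :: nat \<Rightarrow> real). x i"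
  have Ym: "?Y i \<in> borel_measurable (euclid d)" if "i \<in> {1..d}" for i
    using that by simp
  have YK: "?Y i \<in> borel_measurable K" if "i \<in> {1..d}" for i
    using that unfolding K_def by simp
  have marg: "distr K borel (?Y i) = distr N borel (Z i)" if "i \<in> {1..d}" for i
    unfolding K_def distr_distr[OF Ym[OF that] Wm]
    by (rule distr_cong) (use that in \<open>auto simp: W_def\<close>)
  have "distributed K lborel (?Y i) std_normal_density" if i: "i \<in> {1..d}" for i
    using dist[OF i] marg[OF i] YK[OF i] Zm[OF i]
    by (simp add: distributed_def cong: distr_cong)
  moreover have "K.indep_vars (\<lambda>_. borel) ?Y {1..d}"
  proof (cases "d = 0")
    case True
    then show ?thesis by (simp add: K.indep_vars_def K.indep_sets_def)
  next
    case False
    then have ne: "{1..d} \<noteq> {}" by auto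
    have "distr K (euclid d) (\<lambda>x. \<lambda>i\<in>{1..d}. ?Y i x) = distr K (euclid d) (\<lambda>x. x)"
      by (rule distr_cong)
        (auto simp: K_def space_PiM PiE_def extensional_def restrict_def fun_eq_iff)
    also have "\<dots> = K" by (rule distr_id2) (simp add: K_def)
    also have "\<dots> = PiM {1..d} (\<lambda>i. distr N borel (Z i))"
      using indep N.indep_vars_iff_distr_eq_PiM'[OF ne, of Z "\<lambda>_. borel"] Zm
      unfolding K_def W_def[abs_def] by simp
    also have "\<dots> = PiM {1..d} (\<lambda>i. distr K borel (?Y i))"
      by (rule PiM_cong) (simp_all add: marg)
    finally show ?thesis
      using K.indep_vars_iff_distr_eq_PiM'[OF ne, of ?Y "\<lambda>_. borel"] YK by simp
  qed
  ultimately have gauss: "iid_std_gaussian K d ?Y"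
    by (simp add: iid_std_gaussian_def K.prob_space_axioms)
  have "distr K (euclid d) (normalized d ?Y) = distr N (euclid d) (normalized d ?Y \<circ> W)"
    unfolding K_def by (rule distr_distr[OF normalized_measurable Wm]) simp
  also have "\<dots> = distr N (euclid d) (normalized d Z)"
    by (rule distr_cong) (auto simp: normalized_def W_def fun_eq_iff)
  finally show ?thesis
    unfolding unif_sphere_def using V gauss eq by metis
qed

definition weighted_sum :: "nat \<Rightarrow> nat \<Rightarrow> ('a \<Rightarrow> nat \<Rightarrow> real) \<Rightarrow> (nat \<Rightarrow> 'a \<Rightarrow> nat \<Rightarrow> real)
    \<Rightarrow> 'a \<Rightarrow> nat \<Rightarrow> real" where
  "weighted_sum d n L U \<omega> = (\<lambda>i\<in>{1..d}. \<Sum>k=1..n. L \<omega> k * U k \<omega> i)"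

end

theory Submission
  imports Defs
begin

text \<open>
Expanding the square gives
\<open>|S|\<^sup>2 = (\<Sum>k l. L\<^sub>k L\<^sub>l \<langle>U\<^sub>k, U\<^sub>l\<rangle>)\<close>. There are finitely many terms and \<open>L\<close> does not vary with \<open>d\<close>, so it
suffices that almost surely \<open>\<langle>U\<^sub>k, U\<^sub>l\<rangle>\<close> tends to 1 for \<open>k = l\<close> and to 0 for \<open>k \<noteq> l\<close>. The first holds
because the vectors have length 1 almost surely (lemma \<open>unif_sphere_norm\<close>). The second expresses
that independent directions in high dimension are nearly orthogonal.

As nothing links different dimensions, almost sure convergence to 0 has to come from summable
probabilities and Borel--Cantelli (lemma \<open>AE_inner_on_tendsto_0\<close>). Condition on \<open>U\<^sub>l = v\<close> and write
\<open>U\<^sub>k = Z / |Z|\<close> with a Gaussian vector \<open>Z\<close>. If \<open>\<langle>U\<^sub>k, v\<rangle> \<ge> \<epsilon>\<close>, then either \<open>|Z|\<^sup>2 \<le> d / 3\<close>, or the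
standard Gaussian variable \<open>\<langle>Z, v\<rangle>\<close> is at least \<open>\<epsilon> * sqrt (d / 3)\<close>. Chernoff's bound controls both
events (lemmas \<open>gaussian_norm_lower_tail\<close> and \<open>gaussian_linear_upper_tail\<close>) by geometric sequences
in \<open>d\<close>, uniformly in the unit vector \<open>v\<close>.
\<close>

section \<open>Inner product on finitely many coordinates\<close>

definition inner_on :: "nat \<Rightarrow> (nat \<Rightarrow> real) \<Rightarrow> (nat \<Rightarrow> real) \<Rightarrow> real" where
  "inner_on d u v = (\<Sum>i=1..d. u i * v i)"

lemma L2_set_power2_eq_inner_on: "(L2_set u {1..d})\<^sup>2 = inner_on d u u"
  by (simp add: L2_set_def inner_on_def sum_nonneg power2_eq_square)

lemma inner_on_measurable [measurable]:
  assumes "f \<in> measurable M (euclid d)" "g \<in> measurable M (euclid d)"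
  shows "(\<lambda>x. inner_on d (f x) (g x)) \<in> borel_measurable M"
  unfolding inner_on_def
  by (intro borel_measurable_sum borel_measurable_times
      measurable_compose[OF assms(1) measurable_component_singleton]
      measurable_compose[OF assms(2) measurable_component_singleton]) auto

lemma inner_on_const_measurable [measurable]:
  assumes "f \<in> measurable M (euclid d)"
  shows "(\<lambda>x. inner_on d (f x) v) \<in> borel_measurable M"
  unfolding inner_on_def
  by (intro borel_measurable_sum borel_measurable_times
      measurable_compose[OF assms measurable_component_singleton]) auto

section \<open>Gaussian tail bounds\<close>

lemma nn_integral_normal_density:
  assumes "\<sigma> > 0"
  shows "(\<integral>\<^sup>+x. ennreal (normal_density \<mu> \<sigma> x) \<partial>lborel) = 1"
  using assms by (subst nn_integral_eq_integral) (auto simp: normal_density_nonneg)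

lemma iid_std_gaussian_measurable:
  assumes "iid_std_gaussian N d Z" "i \<in> {1..d}"
  shows "Z i \<in> borel_measurable N"
  using assms by (auto simp: iid_std_gaussian_def distributed_def)

text \<open>
Both exponential moments below are expectations of a product with one factor per coordinate,
so independence reduces them to integrals over the line.
\<close>
lemma nn_integral_prod_gaussian:
  fixes f :: "nat \<Rightarrow> real \<Rightarrow> real"
  assumes Z: "iid_std_gaussian N d Z"
    and f [measurable]: "\<And>i. f i \<in> borel_measurable borel"
    and nn: "\<And>i x. f i x \<ge> 0"
  shows "(\<integral>\<^sup>+\<omega>. ennreal (\<Prod>i=1..d. f i (Z i \<omega>)) \<partial>N) =
    (\<Prod>i=1..d. \<integral>\<^sup>+x. ennreal (std_normal_density x * f i x) \<partial>lborel)"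
proof -
  interpret N: prob_space N
    using Z by (simp add: iid_std_gaussian_def)
  have ind: "N.indep_vars (\<lambda>_. borel) Z {1..d}"
    and dist: "\<And>i. i \<in> {1..d} \<Longrightarrow> distributed N lborel (Z i) std_normal_density"
    using Z by (auto simp: iid_std_gaussian_def)
  have ind': "N.indep_vars (\<lambda>_. borel) (\<lambda>i \<omega>. ennreal (f i (Z i \<omega>))) {1..d}"
    using N.indep_vars_compose2[OF ind, of "\<lambda>i x. ennreal (f i x)" "\<lambda>_. borel"] by simp
  have "(\<integral>\<^sup>+\<omega>. ennreal (\<Prod>i=1..d. f i (Z i \<omega>)) \<partial>N) =
      (\<integral>\<^sup>+\<omega>. (\<Prod>i=1..d. ennreal (f i (Z i \<omega>))) \<partial>N)"
    by (simp add: prod_ennreal nn)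
  also have "\<dots> = (\<Prod>i=1..d. \<integral>\<^sup>+\<omega>. ennreal (f i (Z i \<omega>)) \<partial>N)"
    by (rule N.indep_vars_nn_integral) (use ind' in auto)
  also have "\<dots> = (\<Prod>i=1..d. \<integral>\<^sup>+x. ennreal (std_normal_density x * f i x) \<partial>lborel)"
  proof (rule prod.cong[OF refl])
    fix i assume "i \<in> {1..d}"
    from distributed_nn_integral[OF dist[OF this], of "\<lambda>x. ennreal (f i x)"]
    show "(\<integral>\<^sup>+\<omega>. ennreal (f i (Z i \<omega>)) \<partial>N) =
        (\<integral>\<^sup>+x. ennreal (std_normal_density x * f i x) \<partial>lborel)"
      by (simp add: ennreal_mult nn)
  qed
  finally show ?thesis .
qed

text \<open>
Chernoff's bound with the parameter \<open>3/2\<close>, for which the Laplace transform of the square of a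
standard Gaussian takes the rational value \<open>1/2\<close>. The threshold \<open>d/3\<close> lies far enough below the
mean \<open>d\<close> that the resulting ratio \<open>exp (1/2) / 2\<close> is less than 1.
\<close>
lemma gaussian_norm_lower_tail:
  assumes Z: "iid_std_gaussian N d Z"
  shows "measure N {\<omega> \<in> space N. (\<Sum>i=1..d. (Z i \<omega>)\<^sup>2) \<le> real d / 3} \<le> (exp (1/2) / 2) ^ d"
proof -
  interpret N: prob_space N
    using Z by (simp add: iid_std_gaussian_def)
  let ?Q = "\<lambda>\<omega>. \<Sum>i=1..d. (Z i \<omega>)\<^sup>2"
  have Qm [measurable]: "?Q \<in> borel_measurable N"
    by (intro borel_measurable_sum borel_measurable_power iid_std_gaussian_measurable[OF Z])
  \<comment> \<open>Tilting the standard Gaussian yields half of the Gaussian density of variance \<open>1/4\<close>.\<close>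
  have dens: "std_normal_density x * exp (- (3/2) * x\<^sup>2) = 1/2 * normal_density 0 (1/2) x" for x
  proof -
    have "sqrt (2 * pi * (1/2)\<^sup>2) = sqrt (2 * pi) / 2"
      by (intro real_sqrt_unique) (auto simp: power_divide)
    then show ?thesis
      by (simp add: normal_density_def mult_exp_exp power2_eq_square field_simps)
  qed
  have one: "(\<integral>\<^sup>+x. ennreal (std_normal_density x * exp (- (3/2) * x\<^sup>2)) \<partial>lborel) = ennreal (1/2)"
    unfolding dens
    by (subst ennreal_mult) (auto simp: normal_density_nonneg nn_integral_cmult nn_integral_normal_density)
  have "emeasure N {\<omega> \<in> space N. ?Q \<omega> \<le> real d / 3} \<le>
     ennreal (exp (3/2 * (real d / 3))) *
       (\<integral>\<^sup>+\<omega>. ennreal (exp (- (3/2) * ?Q \<omega>)) * indicator (space N) \<omega> \<partial>N)"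
    by (rule Chernoff_ineq_nn_integral_le[OF _ sets.top Qm]) auto
  also have "(\<integral>\<^sup>+\<omega>. ennreal (exp (- (3/2) * ?Q \<omega>)) * indicator (space N) \<omega> \<partial>N) =
      (\<integral>\<^sup>+\<omega>. ennreal (\<Prod>i=1..d. exp (- (3/2) * (Z i \<omega>)\<^sup>2)) \<partial>N)"
    by (intro nn_integral_cong) (simp add: sum_distrib_left exp_sum flip: sum_negf)
  also have "\<dots> = (\<Prod>i=1..d. ennreal (1/2))"
    by (subst nn_integral_prod_gaussian[OF Z, where f="\<lambda>_ x. exp (- (3/2) * x\<^sup>2)"])
      (simp_all only: one, auto)
  also have "ennreal (exp (3/2 * (real d / 3))) * (\<Prod>i=1..d. ennreal (1/2)) = ennreal ((exp (1/2) / 2) ^ d)"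
    by (simp add: ennreal_power ennreal_mult'[symmetric] power_divide exp_of_nat_mult[symmetric] del: ennreal_half)
  finally show ?thesis
    by (simp add: N.emeasure_eq_measure)
qed

text \<open>
A linear form with unit coefficient vector is itself standard Gaussian. Its tail comes from
Chernoff's bound with the optimal parameter \<open>r\<close>; working with the exponential moment coordinate by
coordinate also covers coefficients \<open>v i\<close> that vanish.
\<close>
lemma gaussian_linear_upper_tail:
  assumes Z: "iid_std_gaussian N d Z" and v: "inner_on d v v = 1" and r: "r > 0"
  shows "measure N {\<omega> \<in> space N. r \<le> (\<Sum>i=1..d. Z i \<omega> * v i)} \<le> exp (- (r\<^sup>2 / 2))"
proof -
  interpret N: prob_space N
    using Z by (simp add: iid_std_gaussian_def)
  let ?Y = "\<lambda>\<omega>. \<Sum>i=1..d. Z i \<omega> * v i"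
  have Ym [measurable]: "?Y \<in> borel_measurable N"
    by (intro borel_measurable_sum borel_measurable_times iid_std_gaussian_measurable[OF Z]) auto
  \<comment> \<open>Completing the square: the tilt shifts the mean to \<open>a\<close>.\<close>
  have dens: "std_normal_density x * exp (a * x) = exp (a\<^sup>2 / 2) * normal_density a 1 x" for a x
    by (simp add: normal_density_def mult_exp_exp power2_eq_square field_simps)
  have one: "(\<integral>\<^sup>+x. ennreal (std_normal_density x * exp (a * x)) \<partial>lborel) = ennreal (exp (a\<^sup>2 / 2))" for a
    unfolding dens
    by (subst ennreal_mult) (auto simp: normal_density_nonneg nn_integral_cmult nn_integral_normal_density)
  have "emeasure N {\<omega> \<in> space N. r \<le> ?Y \<omega>} \<le>
     ennreal (exp (- r * r)) * (\<integral>\<^sup>+\<omega>. ennreal (exp (r * ?Y \<omega>)) * indicator (space N) \<omega> \<partial>N)"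
    by (rule Chernoff_ineq_nn_integral_ge[OF r sets.top borel_measurable_times[OF Ym]]) auto
  also have "(\<integral>\<^sup>+\<omega>. ennreal (exp (r * ?Y \<omega>)) * indicator (space N) \<omega> \<partial>N) =
      (\<integral>\<^sup>+\<omega>. ennreal (\<Prod>i=1..d. exp (r * v i * Z i \<omega>)) \<partial>N)"
    by (intro nn_integral_cong) (simp add: sum_distrib_left exp_sum mult_ac)
  also have "\<dots> = (\<Prod>i=1..d. ennreal (exp ((r * v i)\<^sup>2 / 2)))"
    by (subst nn_integral_prod_gaussian[OF Z, where f="\<lambda>i x. exp (r * v i * x)"])
      (simp_all only: one, auto)
  also have "\<dots> = ennreal (exp (\<Sum>i=1..d. (r * v i)\<^sup>2 / 2))"
    by (simp add: prod_ennreal exp_sum)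
  also have "(\<Sum>i=1..d. (r * v i)\<^sup>2 / 2) = r\<^sup>2 / 2"
  proof -
    have "(\<Sum>i=1..d. (r * v i)\<^sup>2 / 2) = r\<^sup>2 / 2 * inner_on d v v"
      unfolding inner_on_def sum_distrib_left by (intro sum.cong) (auto simp: power2_eq_square)
    then show ?thesis using v by simp
  qed
  also have "ennreal (exp (- r * r)) * ennreal (exp (r\<^sup>2 / 2)) = ennreal (exp (- (r\<^sup>2 / 2)))"
    by (simp add: ennreal_mult'[symmetric] mult_exp_exp power2_eq_square field_simps)
  finally show ?thesis
    by (simp add: N.emeasure_eq_measure)
qed

section \<open>Uniform vectors on the sphere\<close>

text \<open>
Only the law of \<open>V\<close> enters an event about \<open>V\<close> alone, so a Gaussian model can replace it.
\<close>
lemma unif_sphere_event: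
  assumes V: "unif_sphere M d V" and A: "A \<in> sets (euclid d)"
  obtains N :: "(nat \<Rightarrow> real) measure" and Z where "iid_std_gaussian N d Z"
    "measure M {\<omega> \<in> space M. V \<omega> \<in> A} = measure N {\<omega> \<in> space N. normalized d Z \<omega> \<in> A}"
proof -
  from V obtain N :: "(nat \<Rightarrow> real) measure" and Z where Vm: "V \<in> measurable M (euclid d)"
    and Z: "iid_std_gaussian N d Z"
    and eq: "distr M (euclid d) V = distr N (euclid d) (normalized d Z)"
    by (auto simp: unif_sphere_def)
  have nm: "normalized d Z \<in> measurable N (euclid d)"
    using iid_std_gaussian_measurable[OF Z] by (rule normalized_measurable)
  have "measure M {\<omega> \<in> space M. V \<omega> \<in> A} = measure (distr M (euclid d) V) A"
    by (subst measure_distr[OF Vm A]) (auto intro!: arg_cong[where f="measure M"])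
  also have "\<dots> = measure N {\<omega> \<in> space N. normalized d Z \<omega> \<in> A}"
    unfolding eq by (subst measure_distr[OF nm A]) (auto intro!: arg_cong[where f="measure N"])
  finally show thesis
    using that Z by blast
qed

lemma inner_on_normalized:
  "inner_on d (normalized d Z \<omega>) v = (\<Sum>i=1..d. Z i \<omega> * v i) / sqrt (\<Sum>i=1..d. (Z i \<omega>)\<^sup>2)"
  unfolding inner_on_def normalized_def sum_divide_distrib by (intro sum.cong) auto

text \<open>
For the normalized Gaussian vector \<open>Z / |Z|\<close> the event says that the linear form \<open>\<langle>Z, v\<rangle>\<close> is at least
\<open>\<epsilon> |Z|\<close>. Either \<open>|Z|\<^sup>2\<close> is atypically small, at most \<open>d/3\<close>, or the linear form, whose standard
deviation is 1, is at least \<open>\<epsilon> * sqrt (d/3)\<close>. Both have exponentially small probability.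
\<close>
lemma unif_sphere_inner_upper_tail:
  assumes V: "unif_sphere M d V" and v: "inner_on d v v = 1"
    and e: "\<epsilon> > 0"
  shows "measure M {\<omega> \<in> space M. \<epsilon> \<le> inner_on d (V \<omega>) v}
    \<le> (exp (1/2) / 2) ^ d + exp (- (\<epsilon>\<^sup>2 / 6)) ^ d"
proof -
  have d: "d > 0"
    using v by (cases d) (auto simp: inner_on_def)
  let ?A = "{u \<in> space (euclid d). \<epsilon> \<le> inner_on d u v}"
  have "?A \<in> sets (euclid d)"
    by measurable
  then obtain N :: "(nat \<Rightarrow> real) measure" and Z where Z: "iid_std_gaussian N d Z"
    and eq: "measure M {\<omega> \<in> space M. V \<omega> \<in> ?A} = measure N {\<omega> \<in> space N. normalized d Z \<omega> \<in> ?A}"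
    by (rule unif_sphere_event[OF V])
  interpret N: prob_space N
    using Z by (simp add: iid_std_gaussian_def)
  have V': "V \<omega> \<in> space (euclid d)" if "\<omega> \<in> space M" for \<omega>
    using V that by (auto simp: unif_sphere_def dest: measurable_space)
  define r where "r = \<epsilon> * sqrt (real d / 3)"
  have r: "r > 0"
    using e d by (simp add: r_def)
  let ?Q = "\<lambda>\<omega>. \<Sum>i=1..d. (Z i \<omega>)\<^sup>2" and ?Y = "\<lambda>\<omega>. \<Sum>i=1..d. Z i \<omega> * v i"
  have [measurable]: "?Q \<in> borel_measurable N"
    by (intro borel_measurable_sum borel_measurable_power iid_std_gaussian_measurable[OF Z])
  have [measurable]: "?Y \<in> borel_measurable N"
    by (intro borel_measurable_sum borel_measurable_times iid_std_gaussian_measurable[OF Z]) auto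
  have sub: "{\<omega> \<in> space N. normalized d Z \<omega> \<in> ?A}
      \<subseteq> {\<omega> \<in> space N. ?Q \<omega> \<le> real d / 3} \<union> {\<omega> \<in> space N. r \<le> ?Y \<omega>}"
  proof safe
    fix \<omega> assume le: "\<epsilon> \<le> inner_on d (normalized d Z \<omega>) v" and "\<not> r \<le> ?Y \<omega>"
    show "?Q \<omega> \<le> real d / 3"
    proof (rule ccontr)
      assume Q: "\<not> ?Q \<omega> \<le> real d / 3"
      moreover have "real d / 3 > 0"
        using d by simp
      ultimately have "sqrt (?Q \<omega>) > 0"
        by simp
      then have "\<epsilon> * sqrt (?Q \<omega>) \<le> ?Y \<omega>"
        using le by (simp add: inner_on_normalized field_simps)
      moreover have "r \<le> \<epsilon> * sqrt (?Q \<omega>)"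
        unfolding r_def using Q e by (intro mult_left_mono real_sqrt_le_mono) auto
      ultimately show False
        using \<open>\<not> r \<le> ?Y \<omega>\<close> by linarith
    qed
  qed
  have "measure M {\<omega> \<in> space M. \<epsilon> \<le> inner_on d (V \<omega>) v} = measure M {\<omega> \<in> space M. V \<omega> \<in> ?A}"
    using V' by (intro arg_cong[where f="measure M"]) auto
  also have "\<dots> \<le> measure N ({\<omega> \<in> space N. ?Q \<omega> \<le> real d / 3} \<union> {\<omega> \<in> space N. r \<le> ?Y \<omega>})"
    unfolding eq by (rule N.finite_measure_mono[OF sub]) measurable
  also have "\<dots> \<le> measure N {\<omega> \<in> space N. ?Q \<omega> \<le> real d / 3} + measure N {\<omega> \<in> space N. r \<le> ?Y \<omega>}"
    by (rule measure_Un_le) measurable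
  also have "\<dots> \<le> (exp (1/2) / 2) ^ d + exp (- (r\<^sup>2 / 2))"
    by (intro add_mono gaussian_norm_lower_tail[OF Z] gaussian_linear_upper_tail[OF Z v r])
  also have "exp (- (r\<^sup>2 / 2)) = exp (- (\<epsilon>\<^sup>2 / 6)) ^ d"
    by (simp add: r_def power_mult_distrib exp_of_nat_mult[symmetric])
  finally show ?thesis .
qed

lemma unif_sphere_inner_tail:
  assumes M: "prob_space M" and V: "unif_sphere M d V" and v: "inner_on d v v = 1" and e: "\<epsilon> > 0"
  shows "measure M {\<omega> \<in> space M. \<epsilon> \<le> \<bar>inner_on d (V \<omega>) v\<bar>}
    \<le> 2 * ((exp (1/2) / 2) ^ d + exp (- (\<epsilon>\<^sup>2 / 6)) ^ d)"
proof -
  interpret prob_space M by (rule M)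
  have [measurable]: "V \<in> measurable M (euclid d)"
    using V by (simp add: unif_sphere_def)
  have neg: "inner_on d u (\<lambda>i. - v i) = - inner_on d u v" for u
    by (simp add: inner_on_def sum_negf)
  have neg1: "inner_on d (\<lambda>i. - v i) (\<lambda>i. - v i) = 1"
    using v by (simp add: inner_on_def)
  have "{\<omega> \<in> space M. \<epsilon> \<le> \<bar>inner_on d (V \<omega>) v\<bar>} =
      {\<omega> \<in> space M. \<epsilon> \<le> inner_on d (V \<omega>) v} \<union>
      {\<omega> \<in> space M. \<epsilon> \<le> inner_on d (V \<omega>) (\<lambda>i. - v i)}"
    unfolding neg using e by auto
  also have "measure M \<dots> \<le> measure M {\<omega> \<in> space M. \<epsilon> \<le> inner_on d (V \<omega>) v} +
      measure M {\<omega> \<in> space M. \<epsilon> \<le> inner_on d (V \<omega>) (\<lambda>i. - v i)}"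
    by (rule measure_Un_le) measurable
  finally show ?thesis
    using unif_sphere_inner_upper_tail[OF V v e] unif_sphere_inner_upper_tail[OF V neg1 e]
    unfolding mult_2 by (meson add_mono order_trans)
qed

text \<open>
Where the Gaussian vector vanishes, division by zero makes its normalization the zero vector; that
event is null because already its first coordinate has a density.
\<close>
lemma unif_sphere_norm:
  assumes V: "unif_sphere M d V" and d: "d > 0"
  shows "AE \<omega> in M. inner_on d (V \<omega>) (V \<omega>) = 1"
proof -
  from V obtain N :: "(nat \<Rightarrow> real) measure" and Z where Vm: "V \<in> measurable M (euclid d)"
    and Z: "iid_std_gaussian N d Z"
    and eq: "distr M (euclid d) V = distr N (euclid d) (normalized d Z)"
    by (auto simp: unif_sphere_def)
  have nm: "normalized d Z \<in> measurable N (euclid d)"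
    using iid_std_gaussian_measurable[OF Z] by (rule normalized_measurable)
  have P: "{u \<in> space (euclid d). inner_on d u u = 1} \<in> sets (euclid d)"
    by measurable
  have dist: "distributed N lborel (Z 1) std_normal_density"
    using Z d by (auto simp: iid_std_gaussian_def)
  have "AE x in density lborel std_normal_density. x \<noteq> (0::real)"
    using AE_lborel_singleton[of "0::real"] by (auto simp: AE_density elim: AE_mp)
  then have "AE x in distr N lborel (Z 1). x \<noteq> (0::real)"
    using dist unfolding distributed_def by metis
  then have "AE \<omega> in N. Z 1 \<omega> \<noteq> 0"
    by (rule AE_distrD[rotated]) (use dist in \<open>simp add: distributed_def\<close>)
  then have "AE \<omega> in N. inner_on d (normalized d Z \<omega>) (normalized d Z \<omega>) = 1"
  proof eventually_elim
    case (elim \<omega>)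
    let ?Q = "\<Sum>i=1..d. (Z i \<omega>)\<^sup>2"
    have "(Z 1 \<omega>)\<^sup>2 \<le> ?Q"
      using d by (intro member_le_sum) auto
    moreover have "(Z 1 \<omega>)\<^sup>2 > 0"
      using elim by simp
    ultimately have Q: "?Q > 0"
      by linarith
    have "inner_on d (normalized d Z \<omega>) (normalized d Z \<omega>) =
        (\<Sum>i=1..d. (Z i \<omega>)\<^sup>2 / ?Q)"
      unfolding inner_on_def normalized_def
      using Q by (intro sum.cong) (auto simp: power2_eq_square[symmetric] power_divide)
    also have "\<dots> = 1"
      using Q by (simp flip: sum_divide_distrib)
    finally show ?case .
  qed
  then show ?thesis
    unfolding AE_distr_iff[OF nm P, symmetric] AE_distr_iff[OF Vm P, symmetric] eq .
qed

text \<open>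
By independence the joint law is a product, so one may freeze \<open>V\<close> at a value \<open>v\<close> and integrate.
Almost every such \<open>v\<close> is a unit vector, and for those the bound for a fixed direction does not
depend on \<open>v\<close>.
\<close>
lemma indep_unif_sphere_inner_tail:
  assumes M: "prob_space M"
    and U: "unif_sphere M d U" and V: "unif_sphere M d V" and d: "d > 0"
    and ind: "prob_space.indep_var M (euclid d) U (euclid d) V" and e: "\<epsilon> > 0"
  shows "measure M {\<omega> \<in> space M. \<epsilon> \<le> \<bar>inner_on d (U \<omega>) (V \<omega>)\<bar>}
    \<le> 2 * ((exp (1/2) / 2) ^ d + exp (- (\<epsilon>\<^sup>2 / 6)) ^ d)" (is "_ \<le> ?b")
proof -
  interpret prob_space M by (rule M)
  have Um: "U \<in> measurable M (euclid d)" and Vm: "V \<in> measurable M (euclid d)"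
    using U V by (auto simp: unif_sphere_def)
  let ?P = "distr M (euclid d) U" and ?R = "distr M (euclid d) V"
  interpret P: prob_space ?P by (rule prob_space_distr[OF Um])
  interpret R: prob_space ?R by (rule prob_space_distr[OF Vm])
  interpret PR: pair_prob_space ?P ?R ..
  let ?A = "{x \<in> space (euclid d \<Otimes>\<^sub>M euclid d). \<epsilon> \<le> \<bar>inner_on d (fst x) (snd x)\<bar>}"
  have A: "?A \<in> sets (euclid d \<Otimes>\<^sub>M euclid d)"
    by measurable
  have slice: "emeasure ?P ((\<lambda>u. (u, v)) -` ?A) \<le> ennreal ?b"
    if v: "inner_on d v v = 1" "v \<in> space (euclid d)" for v
  proof -
    have "(\<lambda>u. (u, v)) -` ?A = {u \<in> space (euclid d). \<epsilon> \<le> \<bar>inner_on d u v\<bar>}"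
      using v by (auto simp: space_pair_measure)
    moreover have "{u \<in> space (euclid d). \<epsilon> \<le> \<bar>inner_on d u v\<bar>} \<in> sets (euclid d)"
      by measurable
    ultimately have "emeasure ?P ((\<lambda>u. (u, v)) -` ?A)
        = emeasure M (U -` {u \<in> space (euclid d). \<epsilon> \<le> \<bar>inner_on d u v\<bar>} \<inter> space M)"
      by (simp only: emeasure_distr[OF Um])
    also have "U -` {u \<in> space (euclid d). \<epsilon> \<le> \<bar>inner_on d u v\<bar>} \<inter> space M
        = {\<omega> \<in> space M. \<epsilon> \<le> \<bar>inner_on d (U \<omega>) v\<bar>}"
      using measurable_space[OF Um] by auto
    finally show ?thesis
      using unif_sphere_inner_tail[OF M U v(1) e]
      by (simp add: emeasure_eq_measure del: ennreal_plus)
  qed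
  have "AE v in ?R. inner_on d v v = 1"
    using unif_sphere_norm[OF V d] by (subst AE_distr_iff[OF Vm]) measurable
  then have ae: "AE v in ?R. emeasure ?P ((\<lambda>u. (u, v)) -` ?A) \<le> ennreal ?b"
    using AE_space by eventually_elim (rule slice, auto)
  have "emeasure M {\<omega> \<in> space M. \<epsilon> \<le> \<bar>inner_on d (U \<omega>) (V \<omega>)\<bar>} =
      emeasure (distr M (euclid d \<Otimes>\<^sub>M euclid d) (\<lambda>\<omega>. (U \<omega>, V \<omega>))) ?A"
    using measurable_space[OF Um] measurable_space[OF Vm]
    by (subst emeasure_distr[OF measurable_Pair[OF Um Vm] A])
      (auto simp: space_pair_measure intro!: arg_cong[where f="emeasure M"])
  also have "\<dots> = emeasure (?P \<Otimes>\<^sub>M ?R) ?A"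
    using ind by (simp add: indep_var_distribution_eq)
  also have "\<dots> = (\<integral>\<^sup>+v. emeasure ?P ((\<lambda>u. (u, v)) -` ?A) \<partial>?R)"
    using A by (intro PR.emeasure_pair_measure_alt2) simp
  also have "\<dots> \<le> (\<integral>\<^sup>+v. ennreal ?b \<partial>?R)"
    by (rule nn_integral_mono_AE[OF ae])
  also have "\<dots> = ennreal ?b"
    using R.emeasure_space_1 by (simp only: nn_integral_const mult_1_right)
  finally show ?thesis
    by (simp add: emeasure_eq_measure del: ennreal_plus)
qed

section \<open>Almost sure orthogonality and the norm of the weighted sum\<close>

text \<open>
The tail probabilities are summable in \<open>d\<close>, so the first Borel--Cantelli lemma applies to each of
the countably many thresholds \<open>1 / (m + 1)\<close>.
\<close>
lemma AE_inner_on_tendsto_0: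
  assumes M: "prob_space M"
    and U: "\<And>d. d \<ge> 2 \<Longrightarrow> unif_sphere M d (U d)" and V: "\<And>d. d \<ge> 2 \<Longrightarrow> unif_sphere M d (V d)"
    and ind: "\<And>d. d \<ge> 2 \<Longrightarrow> prob_space.indep_var M (euclid d) (U d) (euclid d) (V d)"
  shows "AE \<omega> in M. (\<lambda>d. inner_on d (U d \<omega>) (V d \<omega>)) \<longlonglongrightarrow> 0"
proof -
  interpret prob_space M by (rule M)
  have ev: "AE \<omega> in M. \<forall>\<^sub>F d in sequentially. \<bar>inner_on d (U d \<omega>) (V d \<omega>)\<bar> < \<epsilon>"
    if e: "\<epsilon> > 0" for \<epsilon>
  proof -
    \<comment> \<open>The law of the vectors is specified from dimension 2 on only; finitely many \<open>d\<close> do not matter.\<close>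
    define A where "A d = (if d \<ge> 2 then {\<omega> \<in> space M. \<epsilon> \<le> \<bar>inner_on d (U d \<omega>) (V d \<omega>)\<bar>} else {})" for d
    define b where "b d = 2 * ((exp (1/2) / 2) ^ d + exp (- (\<epsilon>\<^sup>2 / 6)) ^ d)" for d :: nat
    have A: "A d \<in> sets M" for d
    proof (cases "d \<ge> 2")
      case True
      then have [measurable]: "U d \<in> measurable M (euclid d)" "V d \<in> measurable M (euclid d)"
        using U V by (auto simp: unif_sphere_def)
      show ?thesis
        using True by (simp only: A_def if_True) measurable
    qed (simp add: A_def)
    have bound: "measure M (A d) \<le> b d" for d
      using indep_unif_sphere_inner_tail[OF M U V _ ind e, of d]
      by (auto simp: A_def b_def)
    have "exp (1/2) < (2::real)"
    proof -
      have "(exp (1/2))\<^sup>2 = exp (1::real)"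
        by (simp add: exp_of_nat_mult[symmetric])
      also have "\<dots> < 2\<^sup>2"
        using exp_le by simp
      finally show ?thesis
        by (rule power2_less_imp_less) simp
    qed
    then have "summable b"
      unfolding b_def using e by (intro summable_mult summable_add summable_geometric) auto
    then have "summable (\<lambda>d. measure M (A d))"
      by (rule summable_comparison_test'[where N=0]) (simp add: bound)
    from borel_cantelli_AE1[OF A _ this]
    have "AE \<omega> in M. \<forall>\<^sub>F d in sequentially. \<omega> \<in> space M - A d"
      by (simp add: emeasure_eq_measure)
    then show ?thesis
    proof eventually_elim
      case (elim \<omega>)
      show ?case
        using elim eventually_ge_at_top[of 2] by eventually_elim (auto simp: A_def)
    qed
  qed
  have "AE \<omega> in M. \<forall>m. \<forall>\<^sub>F d in sequentially. \<bar>inner_on d (U d \<omega>) (V d \<omega>)\<bar> < 1 / real (Suc m)"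
    unfolding AE_all_countable by (intro allI ev) simp
  then show ?thesis
  proof eventually_elim
    case (elim \<omega>)
    show ?case
    proof (rule tendstoI)
      fix e :: real assume "e > 0"
      then obtain m where "1 / real (Suc m) < e"
        by (rule nat_approx_posE)
      then show "\<forall>\<^sub>F d in sequentially. dist (inner_on d (U d \<omega>) (V d \<omega>)) 0 < e"
        using elim[rule_format, of m] by (auto elim!: eventually_mono)
    qed
  qed
qed

lemma (in prob_space) indep_vars_imp_indep_var:
  assumes ind: "indep_vars M' X I" and ij: "i \<in> I" "j \<in> I" "i \<noteq> j"
  shows "indep_var (M' i) (X i) (M' j) (X j)"
proof -
  have "indep_var (M' i) ((\<lambda>x. x i) \<circ> (\<lambda>\<omega>. \<lambda>k\<in>{i}. X k \<omega>)) (M' j) ((\<lambda>x. x j) \<circ> (\<lambda>\<omega>. \<lambda>k\<in>{j}. X k \<omega>))"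
    using ij by (intro indep_var_compose[OF indep_var_restrict[OF ind]]) auto
  then show ?thesis
    by (simp add: comp_def)
qed

lemma inner_on_weighted_sum:
  "inner_on d (weighted_sum d n L U \<omega>) (weighted_sum d n L U \<omega>) =
    (\<Sum>k=1..n. \<Sum>l=1..n. L \<omega> k * L \<omega> l * inner_on d (U k \<omega>) (U l \<omega>))"
proof -
  have "inner_on d (weighted_sum d n L U \<omega>) (weighted_sum d n L U \<omega>) =
      (\<Sum>i=1..d. \<Sum>k=1..n. \<Sum>l=1..n. L \<omega> k * L \<omega> l * (U k \<omega> i * U l \<omega> i))"
    unfolding inner_on_def weighted_sum_def
    by (intro sum.cong) (auto simp: sum_product mult_ac)
  also have "\<dots> = (\<Sum>k=1..n. \<Sum>i=1..d. \<Sum>l=1..n. L \<omega> k * L \<omega> l * (U k \<omega> i * U l \<omega> i))"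
    by (rule sum.swap)
  also have "\<dots> = (\<Sum>k=1..n. \<Sum>l=1..n. \<Sum>i=1..d. L \<omega> k * L \<omega> l * (U k \<omega> i * U l \<omega> i))"
    by (intro sum.cong sum.swap refl)
  finally show ?thesis
    by (simp add: inner_on_def sum_distrib_left)
qed

theorem theorem4p3:
  fixes M :: "'a measure" and n :: nat
    and L :: "'a \<Rightarrow> nat \<Rightarrow> real"
    and U :: "nat \<Rightarrow> nat \<Rightarrow> 'a \<Rightarrow> nat \<Rightarrow> real"
  assumes "prob_space M" and "complete_measure M"
    and "n \<ge> 1"
    and "L \<in> measurable M (euclid n)"
    and "\<And>\<omega> k. \<omega> \<in> space M \<Longrightarrow> k \<in> {1..n} \<Longrightarrow> L \<omega> k \<ge> 0"
    and "\<And>d k. d \<ge> 2 \<Longrightarrow> k \<in> {1..n} \<Longrightarrow> unif_sphere M d (U d k)"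
    and "\<And>d. d \<ge> 2 \<Longrightarrow>
           prob_space.indep_vars M (\<lambda>k. if k = 0 then euclid n else euclid d)
             (\<lambda>k. if k = 0 then L else U d k) {0..n}"
  shows "AE \<omega> in M.
           (\<lambda>d. (L2_set (weighted_sum d n L (U d) \<omega>) {1..d})\<^sup>2)
             \<longlonglongrightarrow> (L2_set (L \<omega>) {1..n})\<^sup>2"
proof -
  interpret prob_space M by fact
  note unif = assms(6)
  have "AE \<omega> in M. (\<lambda>d. inner_on d (U d k \<omega>) (U d l \<omega>)) \<longlonglongrightarrow> of_bool (k = l)"
    if k: "k \<in> {1..n}" and l: "l \<in> {1..n}" for k l
  proof (cases "k = l")
    case True
    have "AE \<omega> in M. \<forall>d. d \<ge> 2 \<longrightarrow> inner_on d (U d k \<omega>) (U d k \<omega>) = 1"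
      unfolding AE_all_countable using unif_sphere_norm[OF unif] k by auto
    then show ?thesis
    proof eventually_elim
      case (elim \<omega>)
      have "\<forall>\<^sub>F d in sequentially. inner_on d (U d k \<omega>) (U d k \<omega>) = 1"
        using eventually_ge_at_top[of 2] by eventually_elim (use elim in blast)
      then show ?case
        using True by (auto intro: tendsto_eventually)
    qed
  next
    case False
    have "indep_var (euclid d) (U d k) (euclid d) (U d l)" if "d \<ge> 2" for d
      using indep_vars_imp_indep_var[OF assms(7)[OF that], of k l] k l False by simp
    then show ?thesis
      using AE_inner_on_tendsto_0[of M "\<lambda>d. U d k" "\<lambda>d. U d l"] unif k l False
      by (simp add: prob_space_axioms)
  qed
  then have "AE \<omega> in M. \<forall>k\<in>{1..n}. \<forall>l\<in>{1..n}.
      (\<lambda>d. inner_on d (U d k \<omega>) (U d l \<omega>)) \<longlonglongrightarrow> of_bool (k = l)"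
    by (intro AE_finite_allI) auto
  then show ?thesis
  proof eventually_elim
    case (elim \<omega>)
    have "(\<lambda>d. \<Sum>k=1..n. \<Sum>l=1..n. L \<omega> k * L \<omega> l * inner_on d (U d k \<omega>) (U d l \<omega>))
        \<longlonglongrightarrow> (\<Sum>k=1..n. \<Sum>l=1..n. L \<omega> k * L \<omega> l * of_bool (k = l))"
      using elim by (intro tendsto_sum tendsto_mult tendsto_const) blast
    also have "(\<Sum>k=1..n. \<Sum>l=1..n. L \<omega> k * L \<omega> l * of_bool (k = l)) = inner_on n (L \<omega>) (L \<omega>)"
      unfolding inner_on_def
      by (intro sum.cong) (auto simp: of_bool_def if_distrib sum.delta cong: if_cong)
    finally show ?case
      unfolding L2_set_power2_eq_inner_on inner_on_weighted_sum .
  qed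
qed

end
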